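(* Let $f:2^X\to\mathbb{R}_{\ge0}$ be monotone submodular, and let the constraint be a single arbitrary matroid $\mathcal{M}=(X,\mathcal{I})$ (the case $p=1$). Run MultipassLocalSearch$(\alpha,\beta_1,\dots,\beta_d)$ with $\alpha=0$ and $\beta_i=1/i$ for each $i$, producing $S_1,\dots,S_d$. Then $2(1+\tfrac1i)f(S_i)\ge f(\mathit{OPT})$ for all $1\le i\le d$. In particular, after $i=2/\varepsilon$ passes, $(2+\varepsilon)f(S_i)\ge f(\mathit{OPT})$.
   Context: $X$ is a finite ground set; $f:2^X\to\mathbb{R}_{\ge 0}$ is submodular and monotone. For $e\in X$, $A\subseteq X$ write $f(e\mid A)=f(A\cup\{e\})-f(A)$. The feasible sets are the independent sets $\mathcal{I}$ of the matroid; $\mathit{OPT}$ is a feasible set maximizing $f$. Elements of $X$ arrive one at a time in a stream; every pass receives all of $X$. Incremental values: given a total order $\prec$ on $X$, $\nu(e,T)=f(e\mid\{t\in T:t\prec e\})$. Exchange$(x,S)$: $C_x=\emptyset$ if $S\cup\{x\}\in\mathcal{I}$; otherwise $C_x=\{t\}$ where $t$ minimizes $\nu(t,S)$ over $\{y\in S:(S\setminus\{y\})\cup\{x\}\in\mathcal{I}\}$. StreamingLocalSearch$(\alpha,\beta,S_{\mathrm{init}})$: $S\leftarrow S_{\mathrm{init}}$; for each arriving $x$: if $x\in S_{\mathrm{init}}$ discard it; otherwise compute $C_x=$ Exchange$(x,S)$ and if $f(x\mid S)\ge\alpha+(1+\beta)\sum_{c\in C_x}\nu(c,S)$ set $S\leftarrow(S\setminus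 C_x)\cup\{x\}$, else reject $x$. Output the final $S$. The order $\prec$ for $\nu$ in a pass is the pretend order: elements of $S_{\mathrm{init}}$ first, in the same relative order as in the pretend order of the pass that produced $S_{\mathrm{init}}$, then elements of $X\setminus S_{\mathrm{init}}$ in arrival order. MultipassLocalSearch$(\alpha,\beta_1,\dots,\beta_d)$: $S_0=\emptyset$; for $i=1,\dots,d$, $S_i$ is the output of StreamingLocalSearch$(\alpha,\beta_i,S_{i-1})$ on a new pass. *)

theory Defs
  imports Complex_Main
begin

definition matroid :: "'a set \<Rightarrow> 'a set set \<Rightarrow> bool" where
  "matroid X \<I> \<longleftrightarrow>
     finite X \<and> \<I> \<subseteq> Pow X \<and> {} \<in> \<I> \<and>
     (\<forall>A B. B \<in> \<I> \<longrightarrow> A \<subseteq> B \<longrightarrow> A \<in> \<I>) \<and>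
     (\<forall>A\<in>\<I>. \<forall>B\<in>\<I>. card A < card B \<longrightarrow> (\<exists>x\<in>B - A. insert x A \<in> \<I>))"

definition submodular_on :: "'a set \<Rightarrow> ('a set \<Rightarrow> real) \<Rightarrow> bool" where
  "submodular_on X f \<longleftrightarrow>
     (\<forall>A B. A \<subseteq> X \<longrightarrow> B \<subseteq> X \<longrightarrow> f (A \<union> B) + f (A \<inter> B) \<le> f A + f B)"

definition marginal :: "('a set \<Rightarrow> real) \<Rightarrow> 'a \<Rightarrow> 'a set \<Rightarrow> real" where
  "marginal f e A = f (A \<union> {e}) - f A"

text \<open>Total orders on the ground set are represented by duplicate-free enumerations of it;
  the next definition is the strict order induced by such a list.\<close>

definition precedes :: "'a list \<Rightarrow> 'a \<Rightarrow> 'a \<Rightarrow> bool" where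
  "precedes ord a b \<longleftrightarrow> (\<exists>i j. i < j \<and> j < length ord \<and> ord ! i = a \<and> ord ! j = b)"

definition incr_value :: "('a set \<Rightarrow> real) \<Rightarrow> 'a list \<Rightarrow> 'a \<Rightarrow> 'a set \<Rightarrow> real" where
  "incr_value f ord e T = marginal f e {t \<in> T. precedes ord t e}"

text \<open>The set \<open>C\<close> is an admissible result of the exchange routine for \<open>x\<close> and \<open>S\<close>. This is a
  relation, so that ties between minimizers may be broken arbitrarily. If \<open>x\<close> is a loop of the
  matroid, there is no element to exchange it with, and no \<open>C\<close> is admissible.\<close>

definition is_exchange ::
  "('a set \<Rightarrow> real) \<Rightarrow> 'a set set \<Rightarrow> 'a list \<Rightarrow> 'a \<Rightarrow> 'a set \<Rightarrow> 'a set \<Rightarrow> bool" where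
  "is_exchange f \<I> ord x S C \<longleftrightarrow>
     (if S \<union> {x} \<in> \<I> then C = {}
      else \<exists>t. C = {t} \<and>
             is_arg_min (\<lambda>y. incr_value f ord y S) (\<lambda>y. y \<in> S \<and> (S - {y}) \<union> {x} \<in> \<I>) t)"

text \<open>One arrival of an element outside the initial set: \<open>S'\<close> is a possible current solution
  after processing \<open>x\<close> with current solution \<open>S\<close>. Loops are rejected.\<close>

definition process ::
  "('a set \<Rightarrow> real) \<Rightarrow> 'a set set \<Rightarrow> real \<Rightarrow> real \<Rightarrow> 'a list \<Rightarrow> 'a \<Rightarrow> 'a set \<Rightarrow> 'a set \<Rightarrow> bool" where
  "process f \<I> \<alpha> \<beta> ord x S S' \<longleftrightarrow>
     (\<exists>C. is_exchange f \<I> ord x S C \<and>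
          S' = (if marginal f x S \<ge> \<alpha> + (1 + \<beta>) * (\<Sum>c\<in>C. incr_value f ord c S)
                then (S - C) \<union> {x} else S)) \<or>
     ((\<nexists>C. is_exchange f \<I> ord x S C) \<and> S' = S)"

text \<open>\<open>local_search_from f \<I> \<alpha> \<beta> ord Sinit xs S T\<close>: starting from the current solution \<open>S\<close> and
  processing the remaining arrivals \<open>xs\<close>, the pass initialized with \<open>Sinit\<close> can output \<open>T\<close>.\<close>

primrec local_search_from ::
  "('a set \<Rightarrow> real) \<Rightarrow> 'a set set \<Rightarrow> real \<Rightarrow> real \<Rightarrow> 'a list \<Rightarrow> 'a set \<Rightarrow> 'a list \<Rightarrow> 'a set \<Rightarrow> 'a set \<Rightarrow> bool"
where
  "local_search_from f \<I> \<alpha> \<beta> ord Sinit [] S T \<longleftrightarrow> T = S"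
| "local_search_from f \<I> \<alpha> \<beta> ord Sinit (x # xs) S T \<longleftrightarrow>
     (\<exists>S'. (if x \<in> Sinit then S' = S else process f \<I> \<alpha> \<beta> ord x S S') \<and>
           local_search_from f \<I> \<alpha> \<beta> ord Sinit xs S' T)"

definition streaming_local_search ::
  "('a set \<Rightarrow> real) \<Rightarrow> 'a set set \<Rightarrow> real \<Rightarrow> real \<Rightarrow> 'a list \<Rightarrow> 'a set \<Rightarrow> 'a list \<Rightarrow> 'a set \<Rightarrow> bool" where
  "streaming_local_search f \<I> \<alpha> \<beta> ord Sinit stream T \<longleftrightarrow>
     local_search_from f \<I> \<alpha> \<beta> ord Sinit stream Sinit T"

text \<open>The pretend order of pass \<open>i\<close>, for \<open>i \<ge> 1\<close>, given the arrival orders \<open>\<sigma>\<close> and the outputs \<open>S\<close>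
  of the passes. The value at \<open>0\<close> is immaterial, because \<open>S 0 = {}\<close>.\<close>

primrec pretend_order :: "(nat \<Rightarrow> 'a list) \<Rightarrow> (nat \<Rightarrow> 'a set) \<Rightarrow> nat \<Rightarrow> 'a list" where
  "pretend_order \<sigma> S 0 = []"
| "pretend_order \<sigma> S (Suc i) =
     filter (\<lambda>x. x \<in> S i) (pretend_order \<sigma> S i) @ filter (\<lambda>x. x \<notin> S i) (\<sigma> (Suc i))"

text \<open>The sequence \<open>S 0, \<dots>, S d\<close> is a possible outcome of \<open>d\<close> passes, where \<open>\<sigma> i\<close> is the stream
  received in pass \<open>i\<close>.\<close>

definition multipass_local_search ::
  "('a set \<Rightarrow> real) \<Rightarrow> 'a set set \<Rightarrow> real \<Rightarrow> (nat \<Rightarrow> real) \<Rightarrow> nat \<Rightarrow> (nat \<Rightarrow> 'a list) \<Rightarrow>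
   (nat \<Rightarrow> 'a set) \<Rightarrow> bool" where
  "multipass_local_search f \<I> \<alpha> \<beta> d \<sigma> S \<longleftrightarrow>
     S 0 = {} \<and>
     (\<forall>i\<in>{1..d}. streaming_local_search f \<I> \<alpha> (\<beta> i) (pretend_order \<sigma> S i) (S (i - 1)) (\<sigma> i) (S i))"

end

theory Submission
  imports Defs
begin

text \<open>Let \<open>A\<close> consist of the initial solution of a pass and all elements accepted in it, and let
  \<open>T\<close> be the output. An accepted element raises the value of the solution by at least its marginal
  value minus the incremental value of the element that it evicts, so if the evicted elements have
  total incremental value \<open>r\<close>, then \<open>f A \<le> f T + r\<close> and \<open>\<beta> r \<le> f T - f S\<^sub>i\<^sub>n\<^sub>i\<^sub>t\<close>. For every
  threshold \<open>\<theta>\<close>, the span of the elements of incremental value at least \<open>\<theta>\<close> only grows during the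
  pass. A rejected element of \<open>OPT\<close> is therefore spanned by the elements of \<open>T\<close> whose value is at
  least that of its exchange partner, and comparing the two level by level shows that the partners
  have total value at most \<open>f T\<close>. Together,
  \<open>f OPT \<le> (2 + \<beta>) f T + (f T - f S\<^sub>i\<^sub>n\<^sub>i\<^sub>t) / \<beta>\<close>, and the bound follows by induction on the passes.\<close>

section \<open>Spans of independent sets\<close>

lemma matroid_subset: "matroid X \<I> \<Longrightarrow> B \<in> \<I> \<Longrightarrow> A \<subseteq> B \<Longrightarrow> A \<in> \<I>"
  unfolding matroid_def by blast

lemma matroid_carrier: "matroid X \<I> \<Longrightarrow> A \<in> \<I> \<Longrightarrow> A \<subseteq> X"
  unfolding matroid_def by blast

lemma matroid_finite: "matroid X \<I> \<Longrightarrow> A \<in> \<I> \<Longrightarrow> finite A"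
  by (meson finite_subset matroid_carrier matroid_def)

lemma matroid_augment:
  "matroid X \<I> \<Longrightarrow> A \<in> \<I> \<Longrightarrow> B \<in> \<I> \<Longrightarrow> card A < card B \<Longrightarrow> \<exists>x\<in>B - A. insert x A \<in> \<I>"
  unfolding matroid_def by blast

text \<open>Augment \<open>A\<close> from \<open>B\<close> one element at a time; the induction is
  on the gap in cardinality.\<close>

lemma matroid_extend:
  assumes M: "matroid X \<I>" and "A \<in> \<I>" "B \<in> \<I>" "card A \<le> card B"
  obtains J where "J \<in> \<I>" "A \<subseteq> J" "J \<subseteq> A \<union> B" "card J = card B"
proof -
  have "\<exists>J\<in>\<I>. A \<subseteq> J \<and> J \<subseteq> A \<union> B \<and> card J = card B"
    using assms(2,4)
  proof (induction "card B - card A" arbitrary: A)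
    case 0
    then show ?case by auto
  next
    case (Suc n)
    then have "card A < card B" by simp
    then obtain x where x: "x \<in> B - A" "insert x A \<in> \<I>"
      using matroid_augment[OF M] Suc.prems assms(3) by blast
    have "card (insert x A) = Suc (card A)"
      using x matroid_finite[OF M Suc.prems(1)] by simp
    then obtain J where "J \<in> \<I>" "insert x A \<subseteq> J" "J \<subseteq> insert x A \<union> B" "card J = card B"
      using Suc.hyps(1)[of "insert x A"] Suc.hyps(2) x \<open>card A < card B\<close> by fastforce
    then show ?case using x by blast
  qed
  then show ?thesis using that by blast
qed

text \<open>This is the matroid closure only for independent \<open>T\<close>.\<close>

definition span_of :: "'a set set \<Rightarrow> 'a set \<Rightarrow> 'a set" where
  "span_of \<I> T = {x. x \<in> T \<or> insert x T \<notin> \<I>}"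

lemma span_of_superset: "T \<subseteq> span_of \<I> T"
  unfolding span_of_def by blast

lemma span_of_mono: "matroid X \<I> \<Longrightarrow> T \<subseteq> T' \<Longrightarrow> span_of \<I> T \<subseteq> span_of \<I> T'"
  unfolding span_of_def using matroid_subset[of X \<I>] by (auto dest: insert_mono)

text \<open>A larger \<open>J\<close> would let augmentation add one of its elements to
  \<open>T\<close>, and such an element lies outside the span.\<close>

lemma card_le_of_subset_span:
  assumes M: "matroid X \<I>" and "T \<in> \<I>" "J \<in> \<I>" "J \<subseteq> span_of \<I> T"
  shows "card J \<le> card T"
  using matroid_augment[OF M, of T J] assms unfolding span_of_def by force

text \<open>Transitivity of closure. If \<open>x\<close> were outside the span of \<open>T'\<close>,
  then \<open>insert x T'\<close> would be independent and at least as large as \<open>T\<close>.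
  Extending \<open>T\<close> to that size cannot pick up \<open>x\<close>, so the extension lies in
  the span of \<open>T'\<close> and yet has more elements than \<open>T'\<close>.\<close>

lemma span_of_subset_span:
  assumes M: "matroid X \<I>" and T: "T \<in> \<I>" and T': "T' \<in> \<I>" and sub: "T \<subseteq> span_of \<I> T'"
  shows "span_of \<I> T \<subseteq> span_of \<I> T'"
proof
  fix x assume x: "x \<in> span_of \<I> T"
  show "x \<in> span_of \<I> T'"
  proof (rule ccontr)
    assume x': "x \<notin> span_of \<I> T'"
    then have ind: "insert x T' \<in> \<I>" "x \<notin> T'" unfolding span_of_def by auto
    have c: "card (insert x T') = Suc (card T')"
      using ind matroid_finite[OF M T'] by simp
    then have "card T \<le> card (insert x T')"
      using card_le_of_subset_span[OF M T' T sub] by simp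
    then obtain J where J: "J \<in> \<I>" "T \<subseteq> J" "J \<subseteq> T \<union> insert x T'" "card J = card (insert x T')"
      using matroid_extend[OF M T ind(1)] by blast
    have "insert x T \<notin> \<I>" using x x' sub unfolding span_of_def by blast
    then have "x \<notin> J" using J(1,2) matroid_subset[OF M, of J "insert x T"] by blast
    then have "J \<subseteq> span_of \<I> T'" using J(3) sub span_of_superset[of T' \<I>] by blast
    then show False using card_le_of_subset_span[OF M T' J(1)] J(4) c by simp
  qed
qed

text \<open>Extend \<open>insert x T\<close> by elements of \<open>S\<close> to size
  \<open>card S\<close>: the result omits exactly one element of \<open>S\<close>, and not one of
  \<open>T\<close>. So an exchange partner can be found outside any part of \<open>S\<close> that
  does not span \<open>x\<close>.\<close>

lemma matroid_exchange:
  assumes M: "matroid X \<I>" and S: "S \<in> \<I>" and T: "T \<subseteq> S" "insert x T \<in> \<I>" "insert x S \<notin> \<I>"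
  obtains y where "y \<in> S - T" "insert x (S - {y}) \<in> \<I>"
proof -
  have fin: "finite S" using matroid_finite[OF M S] .
  have xS: "x \<notin> S" using S T(3) by (metis insert_absorb)
  have "T \<noteq> S" using T by blast
  then have "card T < card S" using T(1) fin by (simp add: psubset_card_mono psubset_eq)
  then have "card (insert x T) \<le> card S"
    using card_insert_le_m1[of "card S" T x] by simp
  then obtain J where J: "J \<in> \<I>" "insert x T \<subseteq> J" "J \<subseteq> insert x T \<union> S" "card J = card S"
    using matroid_extend[OF M T(2) S] by blast
  have "\<not> S \<subseteq> J" using T(3) J(1,2) matroid_subset[OF M, of J "insert x S"] by blast
  then obtain y where y: "y \<in> S" "y \<notin> J" by blast
  have "J \<subseteq> insert x (S - {y})" using J(3) T(1) y by blast
  moreover have "card (insert x (S - {y})) = card S"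
    using fin xS y(1) by (metis DiffD1 card_Suc_Diff1 card_insert_disjoint finite_Diff)
  ultimately have "J = insert x (S - {y})"
    using card_subset_eq[of "insert x (S - {y})" J] fin J(4) by simp
  then show ?thesis using that[of y] J(1,2) y by blast
qed

section \<open>Incremental values\<close>

text \<open>Greedy pairing: an element \<open>p\<close> of largest value is paired with some
  \<open>q\<close> of at least that value. Removing both lowers each count by one at thresholds up
  to \<open>v p\<close>, and above \<open>v p\<close> the counts for \<open>P\<close> are zero, so
  the hypothesis survives.\<close>

lemma sum_le_sum_of_card_level_le:
  fixes v :: "'a \<Rightarrow> real" and w :: "'b \<Rightarrow> real"
  assumes "finite P" "finite Q" "\<And>q. q \<in> Q \<Longrightarrow> 0 \<le> w q"
    and "\<And>\<theta>. card {p\<in>P. \<theta> \<le> v p} \<le> card {q\<in>Q. \<theta> \<le> w q}"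
  shows "sum v P \<le> sum w Q"
  using assms
proof (induction "card P" arbitrary: P Q)
  case 0
  then show ?case by (simp add: sum_nonneg)
next
  case (Suc n)
  then have ne: "P \<noteq> {}" by auto
  have "Max (v ` P) \<in> v ` P" using Suc.prems(1) ne by simp
  then obtain p where p: "p \<in> P" "v p = Max (v ` P)" by (metis imageE)
  have max: "v p' \<le> v p" if "p' \<in> P" for p' using p(2) that Suc.prems(1) by simp
  have "card {p'\<in>P. v p \<le> v p'} > 0" using p(1) Suc.prems(1) by (auto simp: card_gt_0_iff)
  then have "card {q\<in>Q. v p \<le> w q} > 0" using Suc.prems(4)[of "v p"] by linarith
  then obtain q where q: "q \<in> Q" "v p \<le> w q" by (auto simp: card_gt_0_iff)
  have "sum v (P - {p}) \<le> sum w (Q - {q})"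
  proof (rule Suc.hyps(1))
    show "n = card (P - {p})" using Suc.hyps(2) p(1) Suc.prems(1) by simp
    fix \<theta>
    show "card {p' \<in> P - {p}. \<theta> \<le> v p'} \<le> card {q' \<in> Q - {q}. \<theta> \<le> w q'}"
    proof (cases "\<theta> \<le> v p")
      case True
      have "{p' \<in> P - {p}. \<theta> \<le> v p'} = {p' \<in> P. \<theta> \<le> v p'} - {p}"
        "{q' \<in> Q - {q}. \<theta> \<le> w q'} = {q' \<in> Q. \<theta> \<le> w q'} - {q}" by auto
      moreover have "p \<in> {p' \<in> P. \<theta> \<le> v p'}" "q \<in> {q' \<in> Q. \<theta> \<le> w q'}" using True p(1) q by auto
      ultimately show ?thesis using Suc.prems(1,2) Suc.prems(4)[of \<theta>] by (simp add: diff_le_mono)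
    next
      case False
      then have "{p' \<in> P - {p}. \<theta> \<le> v p'} = {}" using max by fastforce
      then show ?thesis by (metis card.empty le0)
    qed
  qed (use Suc.prems in auto)
  moreover have "sum v P = v p + sum v (P - {p})" using p(1) Suc.prems(1) by (simp add: sum.remove)
  moreover have "sum w Q = w q + sum w (Q - {q})" using q Suc.prems(2) by (simp add: sum.remove)
  ultimately show ?case using q(2) by linarith
qed

section \<open>The order induced by a list, and telescoping along it\<close>

lemma precedes_imp_mem: "precedes xs a b \<Longrightarrow> a \<in> set xs \<and> b \<in> set xs"
  unfolding precedes_def by (meson less_trans nth_mem)

lemma precedes_snoc:
  "precedes (xs @ [a]) t e \<longleftrightarrow> precedes xs t e \<or> (e = a \<and> t \<in> set xs)"
proof
  assume "precedes (xs @ [a]) t e"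
  then obtain i j where ij: "i < j" "j < Suc (length xs)" "(xs @ [a]) ! i = t" "(xs @ [a]) ! j = e"
    unfolding precedes_def by auto
  then show "precedes xs t e \<or> (e = a \<and> t \<in> set xs)"
    unfolding precedes_def by (cases "j = length xs") (fastforce simp: nth_append)+
next
  assume "precedes xs t e \<or> (e = a \<and> t \<in> set xs)"
  then show "precedes (xs @ [a]) t e"
  proof
    assume "precedes xs t e"
    then obtain i j where "i < j" "j < length xs" "xs ! i = t" "xs ! j = e"
      unfolding precedes_def by blast
    then show ?thesis
      unfolding precedes_def by (intro exI[of _ i] exI[of _ j]) (simp add: nth_append)
  next
    assume "e = a \<and> t \<in> set xs"
    then obtain i where "e = a" "i < length xs" "xs ! i = t" by (auto simp: in_set_conv_nth)
    then show ?thesis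
      unfolding precedes_def by (intro exI[of _ i] exI[of _ "length xs"]) (simp add: nth_append)
  qed
qed

text \<open>For use at an arrival, with \<open>xs\<close> the part of the pretend order already
  seen: accepting \<open>x\<close> then adds to no predecessor set of a current element.\<close>

lemma not_precedes_of_distinct:
  assumes "distinct (xs @ x # ys)" "e \<in> insert x (set xs)"
  shows "\<not> precedes (xs @ x # ys) x e"
proof
  assume "precedes (xs @ x # ys) x e"
  then obtain i j where ij: "i < j" "j < length (xs @ x # ys)"
    "(xs @ x # ys) ! i = x" "(xs @ x # ys) ! j = e"
    unfolding precedes_def by blast
  have "i = length xs"
    using ij assms(1) nth_eq_iff_index_eq[OF assms(1), of i "length xs"] by simp
  moreover obtain k where "k \<le> length xs" "(xs @ x # ys) ! k = e"
    using assms(2) by (auto simp: in_set_conv_nth) (metis nth_append less_imp_le nth_append_length order_refl)+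
  then have "j \<le> length xs"
    using ij nth_eq_iff_index_eq[OF assms(1), of j k] by simp
  ultimately show False using ij(1) by simp
qed

lemma precedes_irrefl: "distinct xs \<Longrightarrow> \<not> precedes xs a a"
  unfolding precedes_def by (metis less_irrefl less_trans nth_eq_iff_index_eq)

text \<open>Telescoping from the end of \<open>ord\<close>: the last entry precedes nothing, so the
  other values do not change when it is removed, and its own value is its marginal over the rest of
  \<open>S\<close>.\<close>

lemma sum_incr_value:
  assumes "distinct ord" "S \<subseteq> set ord"
  shows "(\<Sum>e\<in>S. incr_value f ord e S) = f S - f {}"
  using assms
proof (induction ord arbitrary: S rule: rev_induct)
  case Nil
  then show ?case by simp
next
  case (snoc a xs)
  have fin: "finite S" using snoc.prems(2) finite_subset by blast
  have a: "a \<notin> set xs" "distinct xs" using snoc.prems(1) by auto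
  have IH: "(\<Sum>e\<in>S - {a}. incr_value f xs e (S - {a})) = f (S - {a}) - f {}"
    using snoc.prems by (intro snoc.IH) auto
  have eq: "incr_value f (xs @ [a]) e S = incr_value f xs e (S - {a})" if "e \<in> S - {a}" for e
  proof -
    have "{t \<in> S. precedes (xs @ [a]) t e} = {t \<in> S - {a}. precedes xs t e}"
      using that a precedes_imp_mem[of xs] by (auto simp: precedes_snoc)
    then show ?thesis unfolding incr_value_def by simp
  qed
  show ?case
  proof (cases "a \<in> S")
    case True
    have "{t \<in> S. precedes (xs @ [a]) t a} = S - {a}"
      using snoc.prems(2) a precedes_imp_mem[of xs] by (auto simp: precedes_snoc)
    then have "incr_value f (xs @ [a]) a S = f S - f (S - {a})"
      unfolding incr_value_def marginal_def using True by (simp add: insert_absorb)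
    then show ?thesis using True fin IH eq by (simp add: sum.remove)
  next
    case False
    then show ?thesis using IH eq by simp
  qed
qed

section \<open>Marginal values of monotone submodular functions\<close>

lemma marginal_nonneg:
  "mono_on (Pow X) f \<Longrightarrow> e \<in> X \<Longrightarrow> A \<subseteq> X \<Longrightarrow> 0 \<le> marginal f e A"
  unfolding marginal_def by (auto intro!: mono_onD[of "Pow X" f])

text \<open>For \<open>e\<close> outside \<open>B\<close> this is submodularity for
  \<open>A \<union> {e}\<close> and \<open>B\<close>. For \<open>e\<close> in \<open>B\<close> the
  left side is 0 and monotonicity takes over, so later uses need not check that \<open>e\<close> is
  new.\<close>

lemma marginal_antimono:
  assumes mono: "mono_on (Pow X) f" and sub: "submodular_on X f"
    and "A \<subseteq> B" "B \<subseteq> X" "e \<in> X"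
  shows "marginal f e B \<le> marginal f e A"
proof (cases "e \<in> B")
  case True
  then have "marginal f e B = 0" unfolding marginal_def by (simp add: insert_absorb)
  then show ?thesis using marginal_nonneg[OF mono, of e A] assms by auto
next
  case False
  have "f ((A \<union> {e}) \<union> B) + f ((A \<union> {e}) \<inter> B) \<le> f (A \<union> {e}) + f B"
    using assms(3-5) sub[unfolded submodular_on_def, rule_format, of "A \<union> {e}" B] by auto
  moreover have "(A \<union> {e}) \<union> B = B \<union> {e}" "(A \<union> {e}) \<inter> B = A" using False assms(3) by auto
  ultimately show ?thesis unfolding marginal_def by simp
qed

lemma submodular_union_le:
  assumes mono: "mono_on (Pow X) f" and sub: "submodular_on X f"
    and "A \<subseteq> X" "B \<subseteq> X" "finite B"
  shows "f (A \<union> B) \<le> f A + (\<Sum>x\<in>B. marginal f x A)"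
  using assms(5,4)
proof (induction B rule: finite_induct)
  case empty
  then show ?case by simp
next
  case (insert x F)
  have "marginal f x (A \<union> F) \<le> marginal f x A"
    using marginal_antimono[OF mono sub, of A "A \<union> F" x] insert.prems assms(3) by auto
  moreover have "f (A \<union> insert x F) = f (A \<union> F) + marginal f x (A \<union> F)"
    unfolding marginal_def by simp
  ultimately show ?case using insert by simp
qed

section \<open>A single pass\<close>

definition level :: "('a set \<Rightarrow> real) \<Rightarrow> 'a list \<Rightarrow> 'a set \<Rightarrow> real \<Rightarrow> 'a set" where
  "level f ord S \<theta> = {s \<in> S. \<theta> \<le> incr_value f ord s S}"

lemma level_subset: "level f ord S \<theta> \<subseteq> S"
  unfolding level_def by blast

context
  fixes X :: "'a set" and \<I> :: "'a set set" and f :: "'a set \<Rightarrow> real" and ord :: "'a list"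
  assumes M: "matroid X \<I>" and mono: "mono_on (Pow X) f" and sub: "submodular_on X f"
    and ord: "distinct ord" "set ord = X"
begin

lemma incr_value_nonneg: "S \<subseteq> X \<Longrightarrow> e \<in> X \<Longrightarrow> 0 \<le> incr_value f ord e S"
  unfolding incr_value_def by (rule marginal_nonneg[OF mono]) auto

text \<open>The incremental value is a marginal over the predecessors of \<open>c\<close> only,
  hence at least the marginal over all of \<open>S - {c}\<close>.\<close>

lemma value_remove_ge:
  assumes "S \<subseteq> X" "c \<in> S"
  shows "f S - incr_value f ord c S \<le> f (S - {c})"
proof -
  have "marginal f c (S - {c}) \<le> incr_value f ord c S"
    unfolding incr_value_def
    using assms precedes_irrefl[OF ord(1)] by (intro marginal_antimono[OF mono sub]) auto
  moreover have "marginal f c (S - {c}) = f S - f (S - {c})"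
    unfolding marginal_def using assms(2) by (simp add: insert_absorb)
  ultimately show ?thesis by simp
qed

text \<open>Otherwise \<open>matroid_exchange\<close> would produce a partner outside the level set,
  that is, one of strictly smaller value than the minimizer \<open>c\<close>.\<close>

lemma exchange_spanned:
  assumes S: "S \<in> \<I>" and ex: "is_exchange f \<I> ord x S {c}"
  shows "x \<in> span_of \<I> (level f ord S (incr_value f ord c S))"
proof (rule ccontr)
  assume n: "x \<notin> span_of \<I> (level f ord S (incr_value f ord c S))"
  have arg: "insert x S \<notin> \<I>"
    "is_arg_min (\<lambda>y. incr_value f ord y S) (\<lambda>y. y \<in> S \<and> (S - {y}) \<union> {x} \<in> \<I>) c"
    using ex unfolding is_exchange_def by (auto split: if_splits)
  obtain y where "y \<in> S - level f ord S (incr_value f ord c S)" "insert x (S - {y}) \<in> \<I>"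
    using matroid_exchange[OF M S level_subset _ arg(1)] n unfolding span_of_def by blast
  then show False using arg(2) unfolding is_arg_min_def level_def by auto
qed

text \<open>\<open>matroid_exchange\<close> with empty \<open>T\<close> supplies a candidate, and
  finiteness a minimizer. Hence a non-loop is rejected only because its marginal value failed the
  comparison.\<close>

lemma exchange_exists:
  assumes S: "S \<in> \<I>" and x: "{x} \<in> \<I>"
  shows "\<exists>C. is_exchange f \<I> ord x S C"
proof (cases "S \<union> {x} \<in> \<I>")
  case True
  then show ?thesis unfolding is_exchange_def by auto
next
  case False
  define Y where "Y = {y \<in> S. (S - {y}) \<union> {x} \<in> \<I>}"
  have "Y \<noteq> {}" using matroid_exchange[OF M S, of "{}" x] x False unfolding Y_def by auto
  moreover have "finite Y" using matroid_finite[OF M S] unfolding Y_def by simp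
  ultimately have "is_arg_min (\<lambda>y. incr_value f ord y S) (\<lambda>y. y \<in> Y)
      (arg_min_on (\<lambda>y. incr_value f ord y S) Y)"
    unfolding is_arg_min_def by (metis arg_min_if_finite)
  then show ?thesis using False unfolding is_exchange_def Y_def by auto
qed

text \<open>Since \<open>x\<close> comes last, the swap can only shrink the predecessor sets of the
  kept elements, so their values do not drop, and \<open>x\<close> enters with value at least
  \<open>marginal f x S\<close>. An evicted element is thus replaced by one of no smaller
  value.\<close>

lemma accept_step:
  assumes S: "S \<in> \<I>" and x: "x \<in> X" "x \<notin> S"
    and last: "\<And>e. e \<in> insert x S \<Longrightarrow> \<not> precedes ord x e"
    and ex: "is_exchange f \<I> ord x S C" and \<beta>: "\<beta> > 0"
    and acc: "(1 + \<beta>) * (\<Sum>c\<in>C. incr_value f ord c S) \<le> marginal f x S"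
  defines "S' \<equiv> (S - C) \<union> {x}" and "w \<equiv> \<Sum>c\<in>C. incr_value f ord c S"
  shows "S' \<in> \<I>" and "0 \<le> w" and "marginal f x S \<le> f S' - f S + w" and "\<beta> * w \<le> f S' - f S"
    and "level f ord S \<theta> \<subseteq> span_of \<I> (level f ord S' \<theta>)"
proof -
  have SX: "S \<subseteq> X" using matroid_carrier[OF M S] .
  have S'X: "S' \<subseteq> X" using SX x unfolding S'_def by auto
  have cases: "C = {} \<and> S \<union> {x} \<in> \<I> \<or>
    (\<exists>c. C = {c} \<and> c \<in> S \<and> (S - {c}) \<union> {x} \<in> \<I> \<and> insert x S \<notin> \<I>)"
    using ex unfolding is_exchange_def is_arg_min_def by (auto split: if_splits)
  show S'I: "S' \<in> \<I>" using cases unfolding S'_def by auto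
  show w0: "0 \<le> w" unfolding w_def
    using cases incr_value_nonneg[OF SX] SX by (auto intro!: sum_nonneg)
  have "f S - w \<le> f (S - C)" using cases value_remove_ge[OF SX] unfolding w_def by auto
  moreover have "marginal f x S \<le> marginal f x (S - C)"
    using SX x by (intro marginal_antimono[OF mono sub]) auto
  ultimately show gain: "marginal f x S \<le> f S' - f S + w"
    unfolding S'_def marginal_def by simp
  show "\<beta> * w \<le> f S' - f S" using gain acc unfolding w_def by (simp add: algebra_simps)
  have keep: "incr_value f ord e S \<le> incr_value f ord e S'" if "e \<in> S - C" for e
    unfolding incr_value_def
    using that SX last by (intro marginal_antimono[OF mono sub]) (auto simp: S'_def)
  have "marginal f x S \<le> incr_value f ord x S'"
    unfolding incr_value_def
    using SX x last by (intro marginal_antimono[OF mono sub]) (auto simp: S'_def)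
  moreover have "w \<le> (1 + \<beta>) * w" using w0 \<beta> by (simp add: algebra_simps)
  ultimately have new: "w \<le> incr_value f ord x S'" using acc unfolding w_def by linarith
  have keepl: "level f ord S \<theta> - C \<subseteq> level f ord S' \<theta>"
    using keep unfolding level_def S'_def by fastforce
  show "level f ord S \<theta> \<subseteq> span_of \<I> (level f ord S' \<theta>)"
  proof
    fix e assume e: "e \<in> level f ord S \<theta>"
    show "e \<in> span_of \<I> (level f ord S' \<theta>)"
    proof (cases "e \<in> C")
      case False
      then show ?thesis using e keepl span_of_superset[of "level f ord S' \<theta>" \<I>] by blast
    next
      case True
      then have C: "C = {e}" using cases by auto
      then have we: "w = incr_value f ord e S" unfolding w_def by simp
      then have "\<theta> \<le> w" using e unfolding level_def by simp
      then have "x \<in> level f ord S' \<theta>" using new unfolding level_def S'_def by simp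
      moreover have "x \<in> span_of \<I> (level f ord S \<theta>)"
      proof -
        have "level f ord S (incr_value f ord e S) \<subseteq> level f ord S \<theta>"
          using \<open>\<theta> \<le> w\<close> we unfolding level_def by auto
        then show ?thesis
          using exchange_spanned[OF S] ex C span_of_mono[OF M] by blast
      qed
      \<comment> \<open>\<open>e\<close> is the only element that the old level set can lose and
        \<open>x\<close> is in the new one, so this dependent set is contained in the new level set
        with \<open>e\<close> added.\<close>
      then have "insert x (level f ord S \<theta>) \<notin> \<I>" 
        using x(2) unfolding span_of_def level_def by auto
      moreover have "insert x (level f ord S \<theta>) \<subseteq> insert e (level f ord S' \<theta>)"
        using keepl C \<open>x \<in> level f ord S' \<theta>\<close> by auto
      ultimately show ?thesis
        unfolding span_of_def using matroid_subset[OF M] by blast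
    qed
  qed
qed

text \<open>\<open>D\<close> is the set of accepted elements, \<open>r\<close> the total incremental value of the evicted ones, and
  \<open>v\<close> the incremental value of the exchange partner of a rejected element \<open>y\<close>.\<close>

lemma local_search_from_bounds:
  assumes "local_search_from f \<I> 0 \<beta> ord Sinit xs S T" and \<beta>: "\<beta> > 0" and "S \<in> \<I>"
    and "ord = ps @ filter (\<lambda>y. y \<notin> Sinit) xs" and "S \<subseteq> set ps"
  shows "T \<in> \<I> \<and> (\<forall>\<theta>. level f ord S \<theta> \<subseteq> span_of \<I> (level f ord T \<theta>)) \<and>
    (\<exists>D r. D \<subseteq> X \<and> \<beta> * r \<le> f T - f S \<and>
       (\<forall>B. S \<subseteq> B \<longrightarrow> B \<subseteq> X \<longrightarrow> f (B \<union> D) \<le> f B + (f T - f S) + r) \<and>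
       (\<forall>y\<in>set xs - Sinit - D. {y} \<in> \<I> \<longrightarrow>
          (\<exists>v. y \<in> span_of \<I> (level f ord T v) \<and> marginal f y (S \<union> D) \<le> (1 + \<beta>) * v)))"
    (is "?G S T xs")
  using assms(1,3-5)
proof (induction xs arbitrary: S ps)
  case Nil
  then have "T = S" by simp
  then show ?case
    using Nil.prems(2) by (auto simp: span_of_def intro!: exI[of _ "{}"] exI[of _ 0])
next
  case (Cons x xs)
  show ?case
  proof (cases "x \<in> Sinit")
    case True
    then have "?G S T xs" using Cons.prems by (intro Cons.IH[of S ps]) auto
    moreover have "set (x # xs) - Sinit - D = set xs - Sinit - D" for D using True by auto
    ultimately show ?thesis by simp
  next
    case False
    then obtain S' where pr: "process f \<I> 0 \<beta> ord x S S'"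
      and rest: "local_search_from f \<I> 0 \<beta> ord Sinit xs S' T"
      using Cons.prems(1) by auto
    have o: "ord = ps @ x # filter (\<lambda>y. y \<notin> Sinit) xs" using Cons.prems(3) False by simp
    have x: "x \<in> X" "x \<notin> S" using o ord Cons.prems(4) by auto
    have SX: "S \<subseteq> X" using matroid_carrier[OF M Cons.prems(2)] .
    \<comment> \<open>\<open>ps\<close> is the part of \<open>ord\<close> already seen. Appending
      \<open>x\<close> keeps every current element in it, so the next arrival again comes after all
      of them.\<close>
    have IH: "?G S' T xs" if "S' \<in> \<I>" "S' \<subseteq> insert x S"
      using rest that o Cons.prems(4) by (intro Cons.IH[of S' "ps @ [x]"]) auto
    \<comment> \<open>A loop also leads to \<open>rej\<close>, whose second fact is therefore
      conditional on \<open>{x} \<in> \<I>\<close>.\<close>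
    consider (acc) C where "is_exchange f \<I> ord x S C" "S' = (S - C) \<union> {x}"
        "(1 + \<beta>) * (\<Sum>c\<in>C. incr_value f ord c S) \<le> marginal f x S"
      | (rej) "S' = S" "{x} \<in> \<I> \<Longrightarrow> \<exists>C. is_exchange f \<I> ord x S C \<and>
          marginal f x S < (1 + \<beta>) * (\<Sum>c\<in>C. incr_value f ord c S)"
      using pr exchange_exists[OF Cons.prems(2), of x] unfolding process_def
      by (smt (verit, best))
    then show ?thesis
    proof cases
      case acc
      define w where "w = (\<Sum>c\<in>C. incr_value f ord c S)"
      have last: "\<not> precedes ord x e" if "e \<in> insert x S" for e
        using not_precedes_of_distinct[of ps x "filter (\<lambda>y. y \<notin> Sinit) xs" e] that Cons.prems(4)
          ord(1) o by auto
      note step = accept_step[OF Cons.prems(2) x last acc(1) \<beta> acc(3), folded acc(2) w_def]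
      have S'X: "S' \<subseteq> X" using matroid_carrier[OF M step(1)] .
      obtain D r where T: "T \<in> \<I>" and lev: "\<And>\<theta>. level f ord S' \<theta> \<subseteq> span_of \<I> (level f ord T \<theta>)"
        and D: "D \<subseteq> X" and r: "\<beta> * r \<le> f T - f S'"
        and B: "\<And>B. S' \<subseteq> B \<Longrightarrow> B \<subseteq> X \<Longrightarrow> f (B \<union> D) \<le> f B + (f T - f S') + r"
        and y: "\<And>y. y \<in> set xs - Sinit - D \<Longrightarrow> {y} \<in> \<I> \<Longrightarrow>
          \<exists>v. y \<in> span_of \<I> (level f ord T v) \<and> marginal f y (S' \<union> D) \<le> (1 + \<beta>) * v"
        using IH step(1) acc(2) by (elim meta_impE) auto
      have levI: "level f ord U \<theta> \<in> \<I>" if "U \<in> \<I>" for U \<theta>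
        using matroid_subset[OF M that level_subset] .
      have "level f ord S \<theta> \<subseteq> span_of \<I> (level f ord T \<theta>)" for \<theta>
        using step(5)[of \<theta>] span_of_subset_span[OF M levI[OF step(1)] levI[OF T] lev] by blast
      moreover have "\<beta> * (r + w) \<le> f T - f S" using r step(4) by (simp add: algebra_simps)
      moreover have "f (B \<union> insert x D) \<le> f B + (f T - f S) + (r + w)"
        if "S \<subseteq> B" "B \<subseteq> X" for B
      proof -
        \<comment> \<open>The induction hypothesis is applied to \<open>insert x B\<close>, which
          contains \<open>S'\<close> while \<open>B\<close> need not; this is why the bound ranges
          over all supersets of the current solution.\<close>
        have "f (insert x B \<union> D) \<le> f (insert x B) + (f T - f S') + r"
          using that x(1) by (intro B) (auto simp: acc(2))
        moreover have "f (insert x B) - f B \<le> marginal f x S"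
          using marginal_antimono[OF mono sub that x(1)] unfolding marginal_def by simp
        ultimately show ?thesis using step(3) by simp
      qed
      moreover have "\<exists>v. y \<in> span_of \<I> (level f ord T v) \<and>
          marginal f y (S \<union> insert x D) \<le> (1 + \<beta>) * v"
        if "y \<in> set (x # xs) - Sinit - insert x D" "{y} \<in> \<I>" for y
      proof -
        \<comment> \<open>Apart from \<open>x\<close>, the new solution consists of old elements, so
          \<open>S' \<union> D\<close> is contained in \<open>S \<union> insert x D\<close>.\<close>
        have "marginal f y (S \<union> insert x D) \<le> marginal f y (S' \<union> D)"
          using SX D x(1) matroid_carrier[OF M that(2)]
          by (intro marginal_antimono[OF mono sub]) (auto simp: acc(2))
        then show ?thesis using y[of y] that by fastforce
      qed
      ultimately show ?thesis
        using T D x(1) by (intro conjI exI[of _ "insert x D"] exI[of _ "r + w"]) auto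
    next
      case rej
      obtain D r where T: "T \<in> \<I>" and lev: "\<And>\<theta>. level f ord S \<theta> \<subseteq> span_of \<I> (level f ord T \<theta>)"
        and D: "D \<subseteq> X" and r: "\<beta> * r \<le> f T - f S"
        and B: "\<And>B. S \<subseteq> B \<Longrightarrow> B \<subseteq> X \<Longrightarrow> f (B \<union> D) \<le> f B + (f T - f S) + r"
        and y: "\<And>y. y \<in> set xs - Sinit - D \<Longrightarrow> {y} \<in> \<I> \<Longrightarrow>
          \<exists>v. y \<in> span_of \<I> (level f ord T v) \<and> marginal f y (S \<union> D) \<le> (1 + \<beta>) * v"
        using IH rej(1) Cons.prems(2) by (elim meta_impE) auto
      have "\<exists>v. x \<in> span_of \<I> (level f ord T v) \<and> marginal f x (S \<union> D) \<le> (1 + \<beta>) * v"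
        if loop: "{x} \<in> \<I>"
      proof -
        obtain C where C: "is_exchange f \<I> ord x S C"
          "marginal f x S < (1 + \<beta>) * (\<Sum>c\<in>C. incr_value f ord c S)" using rej(2)[OF loop] by blast
        \<comment> \<open>With \<alpha> = 0, an empty exchange set makes the threshold 0, which no
          nonnegative marginal can miss.\<close>
        have "C \<noteq> {}" using C(2) marginal_nonneg[OF mono x(1) SX] by auto
        then obtain c where c: "C = {c}" using C(1) unfolding is_exchange_def by (auto split: if_splits)
        have "x \<in> span_of \<I> (level f ord T (incr_value f ord c S))"
          using exchange_spanned[OF Cons.prems(2)] C(1) c
            span_of_subset_span[OF M matroid_subset[OF M Cons.prems(2) level_subset]
              matroid_subset[OF M T level_subset] lev] by blast
        moreover have "marginal f x (S \<union> D) \<le> marginal f x S"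
          using SX D x(1) by (intro marginal_antimono[OF mono sub]) auto
        ultimately show ?thesis using C(2) c by (intro exI[of _ "incr_value f ord c S"]) auto
      qed
      then have "\<exists>v. y \<in> span_of \<I> (level f ord T v) \<and> marginal f y (S \<union> D) \<le> (1 + \<beta>) * v"
        if "y \<in> set (x # xs) - Sinit - D" "{y} \<in> \<I>" for y
        using y[of y] that by (cases "y = x") auto
      then show ?thesis
        using T lev D r B by (intro conjI exI[of _ D] exI[of _ r]) blast+
    qed
  qed
qed

lemma streaming_local_search_bound:
  assumes run: "streaming_local_search f \<I> 0 \<beta> ord Sinit stream T" and \<beta>: "\<beta> > 0"
    and "Sinit \<in> \<I>" and O: "OPT \<in> \<I>" and nonneg: "f {} \<ge> 0"
    and "ord = ps @ filter (\<lambda>y. y \<notin> Sinit) stream" and "set ps = Sinit" and stream: "set stream = X"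
  shows "T \<in> \<I>" and "f OPT \<le> (2 + \<beta>) * f T + (f T - f Sinit) / \<beta>"
proof -
  obtain D r where T: "T \<in> \<I>" and D: "D \<subseteq> X" and r: "\<beta> * r \<le> f T - f Sinit"
    and B: "\<And>B. Sinit \<subseteq> B \<Longrightarrow> B \<subseteq> X \<Longrightarrow> f (B \<union> D) \<le> f B + (f T - f Sinit) + r"
    and y: "\<And>y. y \<in> set stream - Sinit - D \<Longrightarrow> {y} \<in> \<I> \<Longrightarrow>
      \<exists>v. y \<in> span_of \<I> (level f ord T v) \<and> marginal f y (Sinit \<union> D) \<le> (1 + \<beta>) * v"
    using local_search_from_bounds[OF run[unfolded streaming_local_search_def] \<beta> assms(3,6)] assms(7)
    by auto
  show "T \<in> \<I>" by (rule T)
  define A where "A = Sinit \<union> D"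
  define P where "P = OPT - A"
  have TX: "T \<subseteq> X" and OX: "OPT \<subseteq> X" and AX: "A \<subseteq> X"
    using matroid_carrier[OF M] T O assms(3) D unfolding A_def by auto
  have fin: "finite P" "finite T" "P \<subseteq> X"
    using matroid_finite[OF M] O T OX unfolding P_def by auto
  \<comment> \<open>Elements of \<open>P\<close> are not loops, because \<open>OPT\<close> is
    independent, and they lie outside \<open>Sinit\<close> and \<open>D\<close>, so the pass
    provides a partner value for each.\<close>
  have "\<exists>v. x \<in> span_of \<I> (level f ord T v) \<and> marginal f x A \<le> (1 + \<beta>) * v" if "x \<in> P" for x
    using y[of x] that OX stream matroid_subset[OF M O, of "{x}"] unfolding P_def A_def by blast
  then obtain v where v: "\<And>x. x \<in> P \<Longrightarrow> x \<in> span_of \<I> (level f ord T (v x))"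
    "\<And>x. x \<in> P \<Longrightarrow> marginal f x A \<le> (1 + \<beta>) * v x" by metis
  \<comment> \<open>Each level set of \<open>P\<close> is independent as a part of
    \<open>OPT\<close>, and it is spanned by the level set of \<open>T\<close> at the same
    threshold, so it has no more elements than that.\<close>
  have "sum v P \<le> (\<Sum>s\<in>T. incr_value f ord s T)"
  proof (rule sum_le_sum_of_card_level_le[OF fin(1,2)])
    show "0 \<le> incr_value f ord s T" if "s \<in> T" for s using incr_value_nonneg[OF TX] that TX by auto
    fix \<theta>
    have "{p \<in> P. \<theta> \<le> v p} \<subseteq> span_of \<I> (level f ord T \<theta>)"
    proof
      fix p assume p: "p \<in> {p \<in> P. \<theta> \<le> v p}"
      then have "level f ord T (v p) \<subseteq> level f ord T \<theta>" unfolding level_def by auto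
      then show "p \<in> span_of \<I> (level f ord T \<theta>)" using v(1)[of p] p span_of_mono[OF M] by blast
    qed
    moreover have "{p \<in> P. \<theta> \<le> v p} \<in> \<I>" by (rule matroid_subset[OF M O]) (auto simp: P_def)
    ultimately show "card {p \<in> P. \<theta> \<le> v p} \<le> card {s \<in> T. \<theta> \<le> incr_value f ord s T}"
      using card_le_of_subset_span[OF M matroid_subset[OF M T level_subset]] by (simp add: level_def)
  qed
  also have "\<dots> \<le> f T" using sum_incr_value[OF ord(1), of T f] TX ord(2) nonneg by simp
  finally have vT: "(1 + \<beta>) * sum v P \<le> (1 + \<beta>) * f T" using \<beta> by (intro mult_left_mono) auto
  have "f OPT \<le> f (A \<union> P)"
    using AX fin(3) unfolding P_def by (intro mono_onD[OF mono]) auto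
  also have "\<dots> \<le> f A + (\<Sum>x\<in>P. marginal f x A)"
    by (rule submodular_union_le[OF mono sub AX fin(3,1)])
  also have "\<dots> \<le> f A + (1 + \<beta>) * sum v P"
    using v(2) by (simp add: sum_distrib_left sum_mono)
  \<comment> \<open>Taking \<open>B = Sinit\<close> makes \<open>f Sinit\<close> cancel.\<close>
  also have "f A \<le> f T + r"
    using B[of Sinit] matroid_carrier[OF M assms(3)] unfolding A_def by simp
  also have "r \<le> (f T - f Sinit) / \<beta>" using r \<beta> by (simp add: field_simps)
  finally show "f OPT \<le> (2 + \<beta>) * f T + (f T - f Sinit) / \<beta>"
    using vT by (simp add: algebra_simps)
qed

end

section \<open>Several passes\<close>

text \<open>The guarantee is kept with denominators cleared, so that \<open>n = 0\<close> makes
  sense and only says that \<open>a\<close> is nonnegative. With \<open>k = n + 1\<close>, the first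
  hypothesis times \<open>k\<close> reads \<open>k F \<le> (k+1)^2 b - k^2 a\<close>. Inserting
  \<open>2 k a \<ge> (k-1) F\<close> turns the coefficient of \<open>F\<close> into
  \<open>k (k+1) / 2\<close>, and a factor \<open>k + 1\<close> cancels.\<close>

lemma multipass_step:
  fixes F a b :: real and n :: nat
  assumes step: "F \<le> (2 + 1 / real (Suc n)) * b + (b - a) / (1 / real (Suc n))"
    and prev: "real n * F \<le> 2 * (real n + 1) * a"
  shows "real (Suc n) * F \<le> 2 * (real (Suc n) + 1) * b"
proof -
  define k where "k = real (Suc n)"
  have k: "k > 0" "real n = k - 1" unfolding k_def by auto
  have "k * F \<le> k * ((2 + 1 / k) * b + (b - a) / (1 / k))"
    using step k unfolding k_def[symmetric] by (intro mult_left_mono) auto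
  also have "\<dots> = (k + 1)\<^sup>2 * b - k * (k * a)"
    using k by (simp add: field_simps power2_eq_square)
  finally have 1: "2 * k * F \<le> 2 * (k + 1)\<^sup>2 * b - k * (2 * k * a)" by simp
  have "(k - 1) * F \<le> 2 * k * a" using prev k by simp
  then have "k * ((k - 1) * F) \<le> k * (2 * k * a)" using k(1) by (intro mult_left_mono) auto
  then have "(k + 1) * (k * F) \<le> (k + 1) * (2 * (k + 1) * b)"
    using 1 by (simp add: algebra_simps power2_eq_square)
  then show ?thesis using k(1) unfolding k_def[symmetric] by simp
qed

theorem theorem2:
  fixes X :: "'a set" and \<I> :: "'a set set" and f :: "'a set \<Rightarrow> real" and OPT :: "'a set"
    and d :: nat and \<sigma> :: "nat \<Rightarrow> 'a list" and S :: "nat \<Rightarrow> 'a set"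
  assumes "matroid X \<I>"
    and "\<forall>A\<subseteq>X. f A \<ge> 0"
    and "mono_on (Pow X) f"
    and "submodular_on X f"
    and "is_arg_max f (\<lambda>A. A \<in> \<I>) OPT"
    and "\<forall>i\<in>{1..d}. distinct (\<sigma> i) \<and> set (\<sigma> i) = X"
    and "multipass_local_search f \<I> 0 (\<lambda>i. 1 / real i) d \<sigma> S"
  shows "(\<forall>i\<in>{1..d}. 2 * (1 + 1 / real i) * f (S i) \<ge> f OPT) \<and>
         (\<forall>\<epsilon>::real. \<epsilon> > 0 \<longrightarrow> nat \<lceil>2 / \<epsilon>\<rceil> \<le> d \<longrightarrow> (2 + \<epsilon>) * f (S (nat \<lceil>2 / \<epsilon>\<rceil>)) \<ge> f OPT)"
proof -
  have O: "OPT \<in> \<I>" using assms(5) unfolding is_arg_max_def by simp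
  \<comment> \<open>The induction starts at \<open>n = 0\<close>, where the value bound reduces to
    nonnegativity of \<open>f {}\<close>. The pretend order there is the empty list, hence the guard
    \<open>n > 0\<close> on its covering \<open>X\<close>.\<close>
  have inv: "S n \<in> \<I> \<and> distinct (pretend_order \<sigma> S n) \<and> S n \<subseteq> X \<and>
      (n > 0 \<longrightarrow> set (pretend_order \<sigma> S n) = X) \<and> real n * f OPT \<le> 2 * (real n + 1) * f (S n)"
    if "n \<le> d" for n
    using that
  proof (induction n)
    case 0
    have "S 0 = {}" using assms(7) unfolding multipass_local_search_def by simp
    then show ?case using assms(1,2) unfolding matroid_def by simp
  next
    case (Suc n)
    define ord where "ord = pretend_order \<sigma> S (Suc n)"
    define ps where "ps = filter (\<lambda>x. x \<in> S n) (pretend_order \<sigma> S n)"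
    have IH: "S n \<in> \<I>" "distinct (pretend_order \<sigma> S n)" "S n \<subseteq> X"
      "n > 0 \<Longrightarrow> set (pretend_order \<sigma> S n) = X" "real n * f OPT \<le> 2 * (real n + 1) * f (S n)"
      using Suc by auto
    have \<sigma>: "distinct (\<sigma> (Suc n))" "set (\<sigma> (Suc n)) = X" using assms(6) Suc.prems by auto
    have run: "streaming_local_search f \<I> 0 (1 / real (Suc n)) ord (S n) (\<sigma> (Suc n)) (S (Suc n))"
      using assms(7) Suc.prems unfolding multipass_local_search_def ord_def
      by (auto dest!: bspec[of _ _ "Suc n"])
    \<comment> \<open>The first pass starts from the empty set, so the empty order at 0 suffices;
      later, the previous pretend order already lists all of \<open>X\<close>.\<close>
    have ps: "set ps = S n"
    proof (cases n)
      case 0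
      then show ?thesis using assms(7) unfolding ps_def multipass_local_search_def by simp
    next
      case Suc
      then show ?thesis using IH(3,4) unfolding ps_def by auto
    qed
    have o: "ord = ps @ filter (\<lambda>y. y \<notin> S n) (\<sigma> (Suc n))" unfolding ord_def ps_def by simp
    have "distinct ps" using IH(2) unfolding ps_def by simp
    then have ord: "distinct ord" "set ord = X" unfolding o using ps \<sigma> IH(3) by auto
    note pass = streaming_local_search_bound[OF assms(1,3,4) ord run _ IH(1) O _ o ps \<sigma>(2)]
    have T: "S (Suc n) \<in> \<I>" and
      b: "f OPT \<le> (2 + 1 / real (Suc n)) * f (S (Suc n)) + (f (S (Suc n)) - f (S n)) / (1 / real (Suc n))"
      using pass assms(2) by auto
    show ?case
      using T ord matroid_carrier[OF assms(1) T] multipass_step[OF b IH(5)]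
      unfolding ord_def[symmetric] by auto
  qed
  have main: "2 * (1 + 1 / real i) * f (S i) \<ge> f OPT" if "i \<in> {1..d}" for i
    using inv[of i] that by (simp add: field_simps)
  moreover have "(2 + \<epsilon>) * f (S (nat \<lceil>2 / \<epsilon>\<rceil>)) \<ge> f OPT" if \<epsilon>: "\<epsilon> > 0" "nat \<lceil>2 / \<epsilon>\<rceil> \<le> d" for \<epsilon> :: real
  proof -
    define i where "i = nat \<lceil>2 / \<epsilon>\<rceil>"
    have i: "2 / \<epsilon> \<le> real i" unfolding i_def by (rule real_nat_ceiling_ge)
    \<comment> \<open>Rounding up a positive number gives at least 1, so \<open>i\<close> is the
      index of an actual pass.\<close>
    have "0 < 2 / \<epsilon>" using \<epsilon>(1) by simp
    then have "real i > 0" using i by linarith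
    then have "i \<in> {1..d}" using \<epsilon>(2) unfolding i_def[symmetric] by simp
    have "2 * (1 + 1 / real i) \<le> 2 + \<epsilon>"
      using i \<epsilon>(1) \<open>real i > 0\<close> by (simp add: field_simps)
    then have "2 * (1 + 1 / real i) * f (S i) \<le> (2 + \<epsilon>) * f (S i)"
      using inv[of i] \<open>i \<in> {1..d}\<close> assms(2) by (intro mult_right_mono) auto
    then show ?thesis using main[OF \<open>i \<in> {1..d}\<close>] unfolding i_def[symmetric] by linarith
  qed
  ultimately show ?thesis by blast
qed

end
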